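(* Let $\vec r: I\to\mathbb{R}^3_1$ be a smooth unit speed timelike curve with Frenet frame $\{\vec t,\vec n,\vec b\}$, curvature $\kappa>0$, torsion $\tau$ and spacelike Darboux vector $\vec D=\tau\vec t-\kappa\vec b$ (that is, $\kappa>|\tau|$ on $I$). Let $\theta$ be the Lorentzian timelike angle between $\vec t$ and $\vec D/\|\vec D\|$, i.e. the smooth function with $\kappa=\|\vec D\|\cosh\theta$ and $\tau=\|\vec D\|\sinh\theta$. Let $c\in\mathbb{R}$ be a constant with $s\neq c$ for all $s\in I$, let $\vec\gamma(s)=\vec r(s)+(c-s)\vec t(s)$ be the corresponding spacelike involute, and let $\{\vec t^*,\vec n^*,\vec b^*\}$ be its Frenet frame. Let $x_1,x_2,x_3\in\mathbb{R}$ be constants such that $\vec X(s)=x_1\vec t^*(s)+x_2\vec n^*(s)+x_3\vec b^*(s)$ is a unit timelike vector, i.e. $x_1^2-x_2^2+x_3^2=-1$. Then the involute trajectory timelike ruled surface $M:\ \varphi(s,v)=\vec\gamma(s)+v\vec X(s)$ is developable if and only if there is a constant $\lambda\in\mathbb{R}$ such that $$\theta(s)=\frac{x_1x_3}{x_3^2-x_2^2}\int\|\vec D\|\,ds+\lambda\qquad\text{on } I,$$ where $\int\|\vec D\|\,ds$ denotes an antiderivative of $s\mapsto\|\vec D(s)\|$ on $I$.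
   Context: $\mathbb{R}^3_1$ is $\mathbb{R}^3$ with the Lorentzian inner product $\langle \vec u,\vec v\rangle=-u_1v_1+u_2v_2+u_3v_3$, and $\|\vec u\|=\sqrt{|\langle\vec u,\vec u\rangle|}$. A vector $\vec u\ne0$ is timelike if $\langle\vec u,\vec u\rangle<0$, and a vector is spacelike if $\langle\vec u,\vec u\rangle>0$. $I\subset\mathbb{R}$ is an open interval and a dot denotes $d/ds$. For a unit speed timelike curve $\vec r$, the Frenet frame consists of $\vec t=\dot{\vec r}$ (timelike), $\vec n$, $\vec b$ (spacelike), with $-\langle\vec t,\vec t\rangle=\langle\vec n,\vec n\rangle=\langle\vec b,\vec b\rangle=1$, pairwise orthogonal, satisfying the Frenet formulas $\dot{\vec t}=\kappa\vec n$, $\dot{\vec n}=\kappa\vec t-\tau\vec b$, $\dot{\vec b}=\tau\vec n$. When $\kappa>|\tau|$, the Darboux vector $\vec D=\tau\vec t-\kappa\vec b$ is spacelike with $\|\vec D\|^2=\kappa^2-\tau^2$. The Frenet frame of the involute $\vec\gamma$ is given by $\vec t^*=\vec n$, $\vec n^*=-\cosh\theta\,\vec t+\sinh\theta\,\vec b$, $\vec b^*=-\sinh\theta\,\vec t+\cosh\theta\,\vec b$ (with $\vec t^*,\vec b^*$ unit spacelike and $\vec n^*$ unit timelike). For a ruled surface $\varphi(s,k)=\vec\gamma(s)+k\vec d(s)$ with unit direction $\vec d$, the distribution parameter is $\delta_d=\dfrac{\det(\dot{\vec\gamma},\vec d,\dot{\vec d})}{\|\dot{\vec d}\|^2}$.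 The surface is called developable if $\delta_d(s)=0$ for all $s\in I$. *)

theory Defs
  imports "HOL-Analysis.Analysis"
begin

section \<open>Minkowski 3-space\<close>

text \<open>Coordinate 1 is the time coordinate.\<close>

definition lorentz :: "real^3 \<Rightarrow> real^3 \<Rightarrow> real" where
  "lorentz u v = - (u $ 1 * v $ 1) + u $ 2 * v $ 2 + u $ 3 * v $ 3"

definition lnorm :: "real^3 \<Rightarrow> real" where
  "lnorm u = sqrt \<bar>lorentz u u\<bar>"

definition timelike :: "real^3 \<Rightarrow> bool" where
  "timelike u \<longleftrightarrow> lorentz u u < 0"

definition spacelike :: "real^3 \<Rightarrow> bool" where
  "spacelike u \<longleftrightarrow> lorentz u u > 0"


section \<open>Curves\<close>

text \<open>Infinite differentiability on an open set of parameters: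
  \<open>F k\<close> is the \<open>k\<close>-th derivative of \<open>f\<close>.\<close>

definition smooth_curve_on :: "real set \<Rightarrow> (real \<Rightarrow> 'a::real_normed_vector) \<Rightarrow> bool" where
  "smooth_curve_on I f \<longleftrightarrow>
     (\<exists>F. F 0 = f \<and>
        (\<forall>k::nat. \<forall>s\<in>I. (F k has_vector_derivative F (Suc k) s) (at s)))"

text \<open>A unit speed timelike curve \<open>r\<close> with its Frenet frame, curvature and torsion.
  Unit speed is \<open>lorentz (t s) (t s) = -1\<close> for the velocity \<open>t\<close>. No orientation
  of the frame is prescribed.\<close>

definition timelike_frenet_on ::
  "real set \<Rightarrow> (real \<Rightarrow> real^3) \<Rightarrow> (real \<Rightarrow> real^3) \<Rightarrow> (real \<Rightarrow> real^3) \<Rightarrow> (real \<Rightarrow> real^3)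
     \<Rightarrow> (real \<Rightarrow> real) \<Rightarrow> (real \<Rightarrow> real) \<Rightarrow> bool" where
  "timelike_frenet_on I r t n b \<kappa> \<tau> \<longleftrightarrow>
     (\<forall>s\<in>I.
        lorentz (t s) (t s) = -1 \<and> lorentz (n s) (n s) = 1 \<and> lorentz (b s) (b s) = 1 \<and>
        lorentz (t s) (n s) = 0 \<and> lorentz (t s) (b s) = 0 \<and> lorentz (n s) (b s) = 0 \<and>
        (r has_vector_derivative t s) (at s) \<and>
        (t has_vector_derivative \<kappa> s *\<^sub>R n s) (at s) \<and>
        (n has_vector_derivative \<kappa> s *\<^sub>R t s - \<tau> s *\<^sub>R b s) (at s) \<and>
        (b has_vector_derivative \<tau> s *\<^sub>R n s) (at s))"

definition darboux ::
  "(real \<Rightarrow> real^3) \<Rightarrow> (real \<Rightarrow> real^3) \<Rightarrow> (real \<Rightarrow> real) \<Rightarrow> (real \<Rightarrow> real) \<Rightarrow> real \<Rightarrow> real^3" where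
  "darboux t b \<kappa> \<tau> s = \<tau> s *\<^sub>R t s - \<kappa> s *\<^sub>R b s"


section \<open>Involutes\<close>

definition involute :: "real \<Rightarrow> (real \<Rightarrow> real^3) \<Rightarrow> (real \<Rightarrow> real^3) \<Rightarrow> real \<Rightarrow> real^3" where
  "involute c r t s = r s + (c - s) *\<^sub>R t s"

text \<open>The Frenet frame of the involute of a timelike curve with spacelike Darboux vector,
  expressed through the frame of that curve and the angle \<open>\<theta>\<close>. The parameter \<open>s\<close> is the
  arc length of the original curve, not of the involute.\<close>

definition involute_tangent :: "(real \<Rightarrow> real^3) \<Rightarrow> real \<Rightarrow> real^3" where
  "involute_tangent n s = n s"

definition involute_normal ::
  "(real \<Rightarrow> real^3) \<Rightarrow> (real \<Rightarrow> real^3) \<Rightarrow> (real \<Rightarrow> real) \<Rightarrow> real \<Rightarrow> real^3" where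
  "involute_normal t b \<theta> s = - cosh (\<theta> s) *\<^sub>R t s + sinh (\<theta> s) *\<^sub>R b s"

definition involute_binormal ::
  "(real \<Rightarrow> real^3) \<Rightarrow> (real \<Rightarrow> real^3) \<Rightarrow> (real \<Rightarrow> real) \<Rightarrow> real \<Rightarrow> real^3" where
  "involute_binormal t b \<theta> s = - sinh (\<theta> s) *\<^sub>R t s + cosh (\<theta> s) *\<^sub>R b s"


section \<open>Ruled surfaces\<close>

text \<open>A ruled surface \<open>\<phi>(s, v) = \<gamma>(s) + v d(s)\<close> is given by its base curve \<open>\<gamma>\<close> and its
  unit direction \<open>d\<close>.\<close>

definition distribution_parameter ::
  "(real \<Rightarrow> real^3) \<Rightarrow> (real \<Rightarrow> real^3) \<Rightarrow> real \<Rightarrow> real" where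
  "distribution_parameter \<gamma> d s =
     det (vector [vector_derivative \<gamma> (at s), d s, vector_derivative d (at s)] :: real^3^3)
       / (lnorm (vector_derivative d (at s)))\<^sup>2"

text \<open>If \<open>d\<close> is unit timelike and its derivative does not vanish, the derivative is spacelike,
  so the denominator above is nonzero.\<close>

definition developable_on ::
  "real set \<Rightarrow> (real \<Rightarrow> real^3) \<Rightarrow> (real \<Rightarrow> real^3) \<Rightarrow> bool" where
  "developable_on I \<gamma> d \<longleftrightarrow> (\<forall>s\<in>I. distribution_parameter \<gamma> d s = 0)"

end

theory Submission
  imports Defs
begin

text \<open>Write \<open>w = \<parallel>D\<parallel>\<close>. Along \<open>r\<close> the frame of the involute satisfies
  \<open>t*' = - w n*\<close>, \<open>n*' = - w t* + \<theta>' b*\<close>, \<open>b*' = \<theta>' n*\<close>, and \<open>\<gamma>' = (c - s) \<kappa> t*\<close>. Hence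
  \<open>det (\<gamma>', X, X')\<close> is a nonzero multiple of \<open>(x\<^sub>2\<^sup>2 - x\<^sub>3\<^sup>2) \<theta>' + x\<^sub>1 x\<^sub>3 w\<close>, while \<open>X'\<close> is
  spacelike. So \<open>M\<close> is developable iff \<open>\<theta>' = x\<^sub>1 x\<^sub>3 / (x\<^sub>3\<^sup>2 - x\<^sub>2\<^sup>2) w\<close>, which integrates to the
  claim because \<open>w = \<kappa> / cosh \<theta>\<close> is continuous.\<close>

section \<open>Gram determinants and Lorentzian algebra\<close>

text \<open>If \<open>A\<close> has rows \<open>u\<close>, \<open>v\<close>, \<open>w\<close> and
  \<open>J = diag(-1, 1, 1)\<close>, the Gram matrix is \<open>A J A^T\<close>, of determinant
  \<open>- (det A)^2\<close>. This makes orthonormal frames independent whatever their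
  orientation.\<close>

lemma det_lorentz_gram:
  fixes u v w :: "real^3"
  shows "(det (vector [u, v, w] :: real^3^3))\<^sup>2 =
    - (lorentz u u * (lorentz v v * lorentz w w - (lorentz v w)\<^sup>2)
       - lorentz u v * (lorentz u v * lorentz w w - lorentz v w * lorentz u w)
       + lorentz u w * (lorentz u v * lorentz v w - lorentz v v * lorentz u w))"
  unfolding det_3 lorentz_def vector_3 by algebra

lemma lorentz_add_left: "lorentz (u + v) w = lorentz u w + lorentz v w"
  and lorentz_add_right: "lorentz w (u + v) = lorentz w u + lorentz w v"
  and lorentz_scaleR_left: "lorentz (a *\<^sub>R u) w = a * lorentz u w"
  and lorentz_scaleR_right: "lorentz w (a *\<^sub>R u) = a * lorentz w u"
  and lorentz_minus_left: "lorentz (- u) w = - lorentz u w"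
  and lorentz_minus_right: "lorentz w (- u) = - lorentz w u"
  and lorentz_diff_left: "lorentz (u - v) w = lorentz u w - lorentz v w"
  and lorentz_diff_right: "lorentz w (u - v) = lorentz w u - lorentz w v"
  and lorentz_commute: "lorentz u v = lorentz v u"
  by (simp_all add: lorentz_def algebra_simps)

lemmas lorentz_bilinear =
  lorentz_add_left lorentz_add_right lorentz_scaleR_left lorentz_scaleR_right
  lorentz_minus_left lorentz_minus_right lorentz_diff_left lorentz_diff_right

lemma continuous_on_lorentz:
  assumes "continuous_on S f" "continuous_on S g"
  shows "continuous_on S (\<lambda>s. lorentz (f s) (g s))"
  unfolding lorentz_def using assms by (intro continuous_intros)

text \<open>The coefficient matrix has first row \<open>(a, 0, 0)\<close>, so its determinant is
  \<open>a\<close> times a 2x2 minor; the rest is multiplicativity of \<open>det\<close>.\<close>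

lemma det_frame_combination:
  fixes u v w :: "real^3"
  shows "det (vector [a *\<^sub>R u, x1 *\<^sub>R u + x2 *\<^sub>R v + x3 *\<^sub>R w, y1 *\<^sub>R u + y2 *\<^sub>R v + y3 *\<^sub>R w] :: real^3^3)
    = a * (x2 * y3 - x3 * y2) * det (vector [u, v, w] :: real^3^3)"
  unfolding det_3 vector_3 by (simp add: algebra_simps)

section \<open>Antiderivatives on an interval and continuity of the curvature\<close>

lemma continuous_on_open_interval_antiderivative:
  fixes f :: "real \<Rightarrow> real"
  assumes "open I" "is_interval I" "continuous_on I f"
  shows "\<exists>F. \<forall>s\<in>I. (F has_real_derivative f s) (at s)"
proof (cases "I = {}")
  case False
  \<comment> \<open>Extended-real endpoints treat bounded and unbounded intervals alike. By openness
    (\<open>bounds\<close>) and convexity (\<open>mem\<close>), \<open>I\<close> consists of the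
    reals strictly between \<open>a\<close> and \<open>b\<close>.\<close>
  define a where "a = Inf (ereal ` I)"
  define b where "b = Sup (ereal ` I)"
  have bounds: "a < ereal s \<and> ereal s < b" if "s \<in> I" for s
  proof -
    obtain e where e: "e > 0" "cball s e \<subseteq> I"
      using assms(1) \<open>s \<in> I\<close> by (meson open_contains_cball)
    then have "s - e \<in> I" "s + e \<in> I"
      by (auto simp: subset_iff dist_real_def)
    then have "a \<le> ereal (s - e)" "ereal (s + e) \<le> b"
      unfolding a_def b_def by (auto intro: Inf_lower Sup_upper)
    moreover have "ereal (s - e) < ereal s" "ereal s < ereal (s + e)"
      using e(1) by simp_all
    ultimately show ?thesis
      by (blast intro: order_le_less_trans order_less_le_trans)
  qed
  have mem: "s \<in> I" if "a < ereal s" "ereal s < b" for s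
  proof -
    from that obtain p q where "p \<in> I" "p < s" "q \<in> I" "s < q"
      unfolding a_def b_def by (auto simp: Inf_less_iff less_Sup_iff)
    then show ?thesis
      using assms(2) by (meson is_interval_1 less_imp_le)
  qed
  have "a < b" using False bounds by (meson all_not_in_conv order_less_trans)
  moreover have "isCont f s" if "a < ereal s" "ereal s < b" for s
    using mem[OF that] assms(1,3) by (simp add: continuous_on_eq_continuous_at)
  ultimately have "\<exists>F. \<forall>s. a < ereal s \<longrightarrow> ereal s < b \<longrightarrow> (F has_vector_derivative f s) (at s)"
    by (intro einterval_antiderivative) auto
  then show ?thesis
    using bounds by (auto simp: has_real_derivative_iff_has_vector_derivative)
qed auto

text \<open>Uniqueness of derivatives identifies \<open>f''\<close> on \<open>I\<close> with
  \<open>F 2\<close> from the tower of derivatives, and \<open>F 2\<close> is itself differentiable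
  there.\<close>

lemma smooth_curve_on_second_derivative_continuous:
  assumes "open I" "smooth_curve_on I f"
    and f: "\<And>s. s \<in> I \<Longrightarrow> (f has_vector_derivative f' s) (at s)"
    and f': "\<And>s. s \<in> I \<Longrightarrow> (f' has_vector_derivative f'' s) (at s)"
  shows "continuous_on I f''"
proof -
  obtain F where F0: "F 0 = f"
    and F: "\<And>k s. s \<in> I \<Longrightarrow> (F k has_vector_derivative F (Suc k) s) (at s)"
    using assms(2) unfolding smooth_curve_on_def by blast
  have eq1: "F 1 s = f' s" if "s \<in> I" for s
    using F[OF that, of 0] f[OF that] vector_derivative_unique_at by (force simp: F0)
  have eq2: "F 2 s = f'' s" if "s \<in> I" for s
  proof -
    \<comment> \<open>\<open>eq1\<close> holds only on \<open>I\<close>; openness of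
      \<open>I\<close> lets the derivative carry over.\<close>
    have "(f' has_vector_derivative F 2 s) (at s)"
      using F[OF that, of 1] eq1 assms(1) that
      by (auto intro: has_vector_derivative_transform_within_open simp: numeral_2_eq_2)
    then show ?thesis using f'[OF that] vector_derivative_unique_at by blast
  qed
  have "continuous_on I (F 2)"
    using F[of _ 2] by (meson continuous_at_imp_continuous_on has_vector_derivative_continuous)
  then show ?thesis using eq2 by (metis continuous_on_cong)
qed

text \<open>The curvature is the Lorentzian product of the continuous second derivative
  \<open>\<kappa> n\<close> of \<open>r\<close> with the continuous unit vector
  \<open>n\<close>.\<close>

lemma curvature_continuous_on:
  assumes "open I" "smooth_curve_on I r" "timelike_frenet_on I r t n b \<kappa> \<tau>"
  shows "continuous_on I \<kappa>"
proof -
  note fr = assms(3)[unfolded timelike_frenet_on_def, rule_format]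
  have "continuous_on I (\<lambda>s. \<kappa> s *\<^sub>R n s)"
    using assms(1,2) fr by (blast intro: smooth_curve_on_second_derivative_continuous)
  moreover have "continuous_on I n"
    using fr by (meson continuous_at_imp_continuous_on has_vector_derivative_continuous)
  ultimately have "continuous_on I (\<lambda>s. lorentz (\<kappa> s *\<^sub>R n s) (n s))"
    by (rule continuous_on_lorentz)
  then show ?thesis
    by (rule continuous_on_cong[THEN iffD1, rotated -1]) (simp_all add: lorentz_scaleR_left fr)
qed

section \<open>Moving frame of the involute\<close>

text \<open>Normal and binormal arise from \<open>-t\<close> and \<open>b\<close> by a hyperbolic
  rotation through \<theta>. Differentiating its coefficients gives the \<open>\<theta>'\<close>
  terms; the Frenet formulas contribute only multiples of \<open>n\<close>.\<close>

lemma involute_frame_derivative: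
  assumes "timelike_frenet_on I r t n b \<kappa> \<tau>" "s \<in> I"
    and \<theta>: "(\<theta> has_real_derivative \<theta>') (at s)"
    and \<kappa>: "\<kappa> s = w * cosh (\<theta> s)" and \<tau>: "\<tau> s = w * sinh (\<theta> s)"
  shows "(involute_tangent n has_vector_derivative - w *\<^sub>R involute_normal t b \<theta> s) (at s)"
    and "(involute_normal t b \<theta> has_vector_derivative
           \<theta>' *\<^sub>R involute_binormal t b \<theta> s - w *\<^sub>R involute_tangent n s) (at s)"
    and "(involute_binormal t b \<theta> has_vector_derivative \<theta>' *\<^sub>R involute_normal t b \<theta> s) (at s)"
proof -
  have t: "(t has_vector_derivative \<kappa> s *\<^sub>R n s) (at s)"
    and n: "(n has_vector_derivative \<kappa> s *\<^sub>R t s - \<tau> s *\<^sub>R b s) (at s)"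
    and b: "(b has_vector_derivative \<tau> s *\<^sub>R n s) (at s)"
    using assms(1,2) unfolding timelike_frenet_on_def by blast+
  have ch: "((\<lambda>s. cosh (\<theta> s)) has_real_derivative sinh (\<theta> s) * \<theta>') (at s)"
    and sh: "((\<lambda>s. sinh (\<theta> s)) has_real_derivative cosh (\<theta> s) * \<theta>') (at s)"
    by (auto intro!: derivative_eq_intros \<theta>)
  have w: "w * (cosh (\<theta> s))\<^sup>2 - w * (sinh (\<theta> s))\<^sup>2 = w"
    by (simp add: cosh_square_eq algebra_simps)
  show "(involute_tangent n has_vector_derivative - w *\<^sub>R involute_normal t b \<theta> s) (at s)"
    using n unfolding involute_tangent_def involute_normal_def \<kappa> \<tau>
    by (simp add: algebra_simps)
  \<comment> \<open>The \<open>n\<close> terms cancel here, since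
    \<open>cosh \<theta> * \<tau> = sinh \<theta> * \<kappa>\<close>.\<close>
  have "((\<lambda>s. - sinh (\<theta> s) *\<^sub>R t s + cosh (\<theta> s) *\<^sub>R b s) has_vector_derivative
      (- sinh (\<theta> s) *\<^sub>R \<kappa> s *\<^sub>R n s + - (cosh (\<theta> s) * \<theta>') *\<^sub>R t s)
      + (cosh (\<theta> s) *\<^sub>R \<tau> s *\<^sub>R n s + (sinh (\<theta> s) * \<theta>') *\<^sub>R b s)) (at s)"
    by (intro has_vector_derivative_add has_vector_derivative_scaleR DERIV_minus ch sh t b)
  then show "(involute_binormal t b \<theta> has_vector_derivative \<theta>' *\<^sub>R involute_normal t b \<theta> s) (at s)"
    unfolding involute_binormal_def involute_normal_def
    by (simp add: \<kappa> \<tau> algebra_simps)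
  have "((\<lambda>s. - cosh (\<theta> s) *\<^sub>R t s + sinh (\<theta> s) *\<^sub>R b s) has_vector_derivative
      (- cosh (\<theta> s) *\<^sub>R \<kappa> s *\<^sub>R n s + - (sinh (\<theta> s) * \<theta>') *\<^sub>R t s)
      + (sinh (\<theta> s) *\<^sub>R \<tau> s *\<^sub>R n s + (cosh (\<theta> s) * \<theta>') *\<^sub>R b s)) (at s)"
    by (intro has_vector_derivative_add has_vector_derivative_scaleR DERIV_minus ch sh t b)
  \<comment> \<open>Here the \<open>n\<close> terms add up to \<open>-w\<close>, by
    \<open>cosh^2 - sinh^2 = 1\<close>.\<close>
  moreover have "- cosh (\<theta> s) *\<^sub>R \<kappa> s *\<^sub>R n s + sinh (\<theta> s) *\<^sub>R \<tau> s *\<^sub>R n s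
      = - (w * (cosh (\<theta> s))\<^sup>2 - w * (sinh (\<theta> s))\<^sup>2) *\<^sub>R n s"
    by (simp add: \<kappa> \<tau> algebra_simps power2_eq_square)
  then have "(- cosh (\<theta> s) *\<^sub>R \<kappa> s *\<^sub>R n s + - (sinh (\<theta> s) * \<theta>') *\<^sub>R t s)
      + (sinh (\<theta> s) *\<^sub>R \<tau> s *\<^sub>R n s + (cosh (\<theta> s) * \<theta>') *\<^sub>R b s)
      = \<theta>' *\<^sub>R (- sinh (\<theta> s) *\<^sub>R t s + cosh (\<theta> s) *\<^sub>R b s) - w *\<^sub>R n s"
    unfolding w by (simp add: algebra_simps)
  ultimately show "(involute_normal t b \<theta> has_vector_derivative
           \<theta>' *\<^sub>R involute_binormal t b \<theta> s - w *\<^sub>R involute_tangent n s) (at s)"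
    unfolding involute_binormal_def involute_normal_def involute_tangent_def by simp
qed

text \<open>The velocity \<open>t\<close> of \<open>r\<close> cancels against the \<open>-t\<close>
  that comes from differentiating \<open>c - s\<close>.\<close>

lemma involute_has_vector_derivative:
  assumes "timelike_frenet_on I r t n b \<kappa> \<tau>" "s \<in> I"
  shows "(involute c r t has_vector_derivative ((c - s) * \<kappa> s) *\<^sub>R involute_tangent n s) (at s)"
proof -
  have r: "(r has_vector_derivative t s) (at s)"
    and t: "(t has_vector_derivative \<kappa> s *\<^sub>R n s) (at s)"
    using assms unfolding timelike_frenet_on_def by blast+
  have "((\<lambda>s. c - s) has_real_derivative -1) (at s)"
    by (auto intro!: derivative_eq_intros)
  from has_vector_derivative_add[OF r has_vector_derivative_scaleR[OF this t]]
  show ?thesis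
    unfolding involute_def involute_tangent_def by simp
qed

text \<open>A hyperbolic rotation of the plane of \<open>-t\<close> and \<open>b\<close> preserves
  the Lorentzian product; \<open>N\<close> takes over the timelike role of \<open>t\<close>.\<close>

lemma involute_frame_orthonormal:
  fixes \<theta> :: "real \<Rightarrow> real"
  assumes "timelike_frenet_on I r t n b \<kappa> \<tau>" "s \<in> I"
  defines "T \<equiv> involute_tangent n s"
    and "N \<equiv> involute_normal t b \<theta> s"
    and "B \<equiv> involute_binormal t b \<theta> s"
  shows "lorentz T T = 1" "lorentz N N = -1" "lorentz B B = 1"
    "lorentz T N = 0" "lorentz T B = 0" "lorentz N B = 0"
proof -
  have "lorentz (t s) (t s) = -1" "lorentz (n s) (n s) = 1" "lorentz (b s) (b s) = 1"
    "lorentz (t s) (n s) = 0" "lorentz (t s) (b s) = 0" "lorentz (n s) (b s) = 0"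
    "lorentz (n s) (t s) = 0" "lorentz (b s) (t s) = 0" "lorentz (b s) (n s) = 0"
    using assms(1,2) unfolding timelike_frenet_on_def by (auto simp: lorentz_commute)
  note fr = this
  show "lorentz T T = 1" "lorentz N N = -1" "lorentz B B = 1"
    "lorentz T N = 0" "lorentz T B = 0" "lorentz N B = 0"
    unfolding T_def N_def B_def involute_tangent_def involute_normal_def involute_binormal_def
    by (simp_all add: lorentz_bilinear fr flip: power2_eq_square)
      (simp_all add: cosh_square_eq)
qed

section \<open>Distribution parameter of the trajectory surface\<close>

text \<open>Everything is expressed in the involute frame. As the base velocity is along
  \<open>T\<close>, only the \<open>N\<close> and \<open>B\<close> coordinates of \<open>X\<close>
  and its derivative enter the determinant.\<close>

lemma distribution_parameter_involute_trajectory: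
  fixes x1 x2 x3 :: real
  assumes frame: "timelike_frenet_on I r t n b \<kappa> \<tau>" "s \<in> I"
    and \<theta>: "(\<theta> has_real_derivative \<theta>') (at s)"
    and \<kappa>: "\<kappa> s = w * cosh (\<theta> s)" and \<tau>: "\<tau> s = w * sinh (\<theta> s)"
    and "w \<noteq> 0" "s \<noteq> c" and unit: "x1\<^sup>2 - x2\<^sup>2 + x3\<^sup>2 = -1"
  defines "X \<equiv> (\<lambda>s. x1 *\<^sub>R involute_tangent n s + x2 *\<^sub>R involute_normal t b \<theta> s
                  + x3 *\<^sub>R involute_binormal t b \<theta> s)"
  shows "distribution_parameter (involute c r t) X s = 0 \<longleftrightarrow>
    \<theta>' = x1 * x3 / (x3\<^sup>2 - x2\<^sup>2) * w"
proof -
  define T where "T = involute_tangent n s"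
  define N where "N = involute_normal t b \<theta> s"
  define B where "B = involute_binormal t b \<theta> s"
  have orth: "lorentz T T = 1" "lorentz N N = -1" "lorentz B B = 1"
    "lorentz T N = 0" "lorentz T B = 0" "lorentz N B = 0"
    unfolding T_def N_def B_def by (rule involute_frame_orthonormal[OF frame])+
  have orth': "lorentz N T = 0" "lorentz B T = 0" "lorentz B N = 0"
    using orth by (simp_all add: lorentz_commute)
  define X' where "X' = (- x2 * w) *\<^sub>R T + (x3 * \<theta>' - x1 * w) *\<^sub>R N + (x2 * \<theta>') *\<^sub>R B"
  have "(X has_vector_derivative x1 *\<^sub>R (- w *\<^sub>R N) + x2 *\<^sub>R (\<theta>' *\<^sub>R B - w *\<^sub>R T) + x3 *\<^sub>R (\<theta>' *\<^sub>R N)) (at s)"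
    unfolding X_def
    using involute_frame_derivative[OF frame \<theta> \<kappa> \<tau>, folded T_def N_def B_def]
    by (intro has_vector_derivative_add
        bounded_linear.has_vector_derivative[OF bounded_linear_scaleR_right])
  also have "x1 *\<^sub>R (- w *\<^sub>R N) + x2 *\<^sub>R (\<theta>' *\<^sub>R B - w *\<^sub>R T) + x3 *\<^sub>R (\<theta>' *\<^sub>R N) = X'"
    unfolding X'_def by (simp add: algebra_simps)
  finally have X': "vector_derivative X (at s) = X'"
    by (rule vector_derivative_at)
  have \<gamma>': "vector_derivative (involute c r t) (at s) = ((c - s) * \<kappa> s) *\<^sub>R T"
    unfolding T_def by (intro vector_derivative_at involute_has_vector_derivative[OF frame])
  have "\<kappa> s \<noteq> 0" using \<open>w \<noteq> 0\<close> \<kappa> by simp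
  \<comment> \<open>The orientation of the frame leaves the sign open; the square suffices for
    nonvanishing.\<close>
  have "(det (vector [T, N, B] :: real^3^3))\<^sup>2 = 1"
    unfolding det_lorentz_gram by (simp add: orth)
  then have det: "det (vector [T, N, B] :: real^3^3) \<noteq> 0" by auto

  \<comment> \<open>A quotient by zero is zero in HOL, so a vanishing parameter means a vanishing
    determinant only once \<open>lnorm X'\<close> is known to be nonzero.\<close>
  have "lorentz X' X' = (x2 * w)\<^sup>2 - (x3 * \<theta>' - x1 * w)\<^sup>2 + (x2 * \<theta>')\<^sup>2"
    unfolding X'_def
    by (simp add: lorentz_bilinear orth orth' power2_eq_square left_diff_distrib right_diff_distrib)
  also have "\<dots> = w\<^sup>2 + \<theta>'\<^sup>2 + (x1 * \<theta>' + x3 * w)\<^sup>2"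
    \<comment> \<open>Lagrange's identity and \<open>x\<^sub>2\<^sup>2 = 1 + x\<^sub>1\<^sup>2 + x\<^sub>3\<^sup>2\<close>\<close>
    using unit by algebra
  also have "\<dots> > 0"
    using \<open>w \<noteq> 0\<close> by (simp add: add_pos_nonneg)
  finally have "lnorm X' \<noteq> 0" by (simp add: lnorm_def)

  have Xs: "X s = x1 *\<^sub>R T + x2 *\<^sub>R N + x3 *\<^sub>R B"
    by (simp add: X_def T_def N_def B_def)
  have det': "det (vector [((c - s) * \<kappa> s) *\<^sub>R T, X s, X'] :: real^3^3) =
      (c - s) * \<kappa> s * (x2 * (x2 * \<theta>') - x3 * (x3 * \<theta>' - x1 * w))
        * det (vector [T, N, B] :: real^3^3)"
    unfolding Xs X'_def by (rule det_frame_combination)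
  have "distribution_parameter (involute c r t) X s = 0 \<longleftrightarrow>
      x2 * (x2 * \<theta>') - x3 * (x3 * \<theta>' - x1 * w) = 0"
    using \<open>lnorm X' \<noteq> 0\<close> \<open>\<kappa> s \<noteq> 0\<close> \<open>s \<noteq> c\<close> det
    by (simp add: distribution_parameter_def X' \<gamma>' det')
  also have "\<dots> \<longleftrightarrow> \<theta>' * (x3\<^sup>2 - x2\<^sup>2) = x1 * x3 * w"
    by (auto simp: algebra_simps power2_eq_square)
  also have "\<dots> \<longleftrightarrow> \<theta>' = x1 * x3 / (x3\<^sup>2 - x2\<^sup>2) * w"
  proof -
    \<comment> \<open>The unit condition gives \<open>x3^2 - x2^2 = -1 - x1^2 < 0\<close>.\<close>
    have "x3\<^sup>2 - x2\<^sup>2 \<noteq> 0"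
      using unit zero_le_power2[of x1] by linarith
    then show ?thesis by (simp add: field_simps)
  qed
  finally show ?thesis .
qed

lemma lnorm_pos_of_spacelike: "spacelike u \<Longrightarrow> lnorm u > 0"
  by (simp add: spacelike_def lnorm_def)

section \<open>Integrating the differential equation for the angle\<close>

text \<open>Forwards, \<open>\<theta> - a F\<close> has zero derivative on a convex set; backwards,
  derivatives are unique. Another choice of \<open>F\<close> only shifts \<mu>.\<close>

lemma affine_antiderivative_iff:
  assumes "open I" and "is_interval I" and F: "\<forall>s\<in>I. (F has_real_derivative f s) (at s)"
    and \<theta>: "\<And>s. s \<in> I \<Longrightarrow> (\<theta> has_real_derivative \<theta>' s) (at s)"
  shows "(\<forall>s\<in>I. \<theta>' s = a * f s) \<longleftrightarrow> (\<exists>\<mu>. \<forall>s\<in>I. \<theta> s = a * F s + \<mu>)"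
proof
  assume eq: "\<forall>s\<in>I. \<theta>' s = a * f s"
  have "((\<lambda>s. \<theta> s - a * F s) has_real_derivative 0) (at s within I)" if "s \<in> I" for s
    using DERIV_diff[OF \<theta>[OF that] DERIV_cmult[OF F[rule_format, OF that], of a]] eq that
    by (simp add: has_field_derivative_at_within)
  from has_field_derivative_zero_constant[OF is_interval_convex[OF assms(2)] this]
  obtain \<mu> where "\<forall>s\<in>I. \<theta> s - a * F s = \<mu>" by blast
  then have "\<forall>s\<in>I. \<theta> s = a * F s + \<mu>" by (simp add: algebra_simps)
  then show "\<exists>\<mu>. \<forall>s\<in>I. \<theta> s = a * F s + \<mu>" ..
next
  assume "\<exists>\<mu>. \<forall>s\<in>I. \<theta> s = a * F s + \<mu>"
  then obtain \<mu> where eq: "\<And>s. s \<in> I \<Longrightarrow> \<theta> s = a * F s + \<mu>" by blast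
  show "\<forall>s\<in>I. \<theta>' s = a * f s"
  proof
    fix s assume s: "s \<in> I"
    have "((\<lambda>s. a * F s + \<mu>) has_real_derivative a * f s) (at s)"
      using F s by (auto intro!: derivative_eq_intros)
    \<comment> \<open>The two functions agree only on \<open>I\<close>, a neighbourhood of
      \<open>s\<close> by openness.\<close>
    then have "(\<theta> has_real_derivative a * f s) (at s)"
      by (rule has_field_derivative_transform_within_open[OF _ assms(1) s]) (simp add: eq)
    with \<theta>[OF s] show "\<theta>' s = a * f s" by (rule DERIV_unique)
  qed
qed

theorem theorem1:
  fixes I :: "real set"
    and r t n b D X :: "real \<Rightarrow> real^3"
    and \<kappa> \<tau> \<theta> :: "real \<Rightarrow> real"
    and c x1 x2 x3 :: real
  assumes "open I" and "is_interval I" and "I \<noteq> {}"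
    and "smooth_curve_on I r"
    and "timelike_frenet_on I r t n b \<kappa> \<tau>"
    and "\<And>s. s \<in> I \<Longrightarrow> \<kappa> s > 0"
    and "D = darboux t b \<kappa> \<tau>"
    and "\<And>s. s \<in> I \<Longrightarrow> spacelike (D s) \<and> \<kappa> s > \<bar>\<tau> s\<bar>"
    and "smooth_curve_on I \<theta>"
    and "\<And>s. s \<in> I \<Longrightarrow> \<kappa> s = lnorm (D s) * cosh (\<theta> s)"
    and "\<And>s. s \<in> I \<Longrightarrow> \<tau> s = lnorm (D s) * sinh (\<theta> s)"
    and "\<And>s. s \<in> I \<Longrightarrow> s \<noteq> c"
    and "X = (\<lambda>s. x1 *\<^sub>R involute_tangent n s + x2 *\<^sub>R involute_normal t b \<theta> s
                  + x3 *\<^sub>R involute_binormal t b \<theta> s)"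
    and "\<And>s. s \<in> I \<Longrightarrow> timelike (X s) \<and> lnorm (X s) = 1"
    and "x1\<^sup>2 - x2\<^sup>2 + x3\<^sup>2 = -1"
  shows "developable_on I (involute c r t) X \<longleftrightarrow>
           (\<exists>F \<mu>. (\<forall>s\<in>I. (F has_real_derivative lnorm (D s)) (at s)) \<and>
                   (\<forall>s\<in>I. \<theta> s = x1 * x3 / (x3\<^sup>2 - x2\<^sup>2) * F s + \<mu>))"
proof -
  obtain \<theta>' where \<theta>: "\<And>s. s \<in> I \<Longrightarrow> (\<theta> has_real_derivative \<theta>' s) (at s)"
    using assms(9) unfolding smooth_curve_on_def has_real_derivative_iff_has_vector_derivative
    by metis
  \<comment> \<open>The pointwise criterion applies with \<open>w = lnorm (D s)\<close>, nonzero
    because \<open>D s\<close> is spacelike.\<close>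
  have dev: "developable_on I (involute c r t) X \<longleftrightarrow>
      (\<forall>s\<in>I. \<theta>' s = x1 * x3 / (x3\<^sup>2 - x2\<^sup>2) * lnorm (D s))"
    unfolding developable_on_def assms(13)
  proof (rule ball_cong[OF refl])
    fix s assume s: "s \<in> I"
    have "lnorm (D s) \<noteq> 0"
      using assms(8)[OF s] lnorm_pos_of_spacelike by force
    then show "distribution_parameter (involute c r t) (\<lambda>s. x1 *\<^sub>R involute_tangent n s
          + x2 *\<^sub>R involute_normal t b \<theta> s + x3 *\<^sub>R involute_binormal t b \<theta> s) s = 0 \<longleftrightarrow>
        \<theta>' s = x1 * x3 / (x3\<^sup>2 - x2\<^sup>2) * lnorm (D s)"
      using s assms(12)
      by (intro distribution_parameter_involute_trajectory[OF assms(5) s \<theta>[OF s]]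
          assms(10,11,15)) auto
  qed
  \<comment> \<open>The forward direction must produce an antiderivative of
    \<open>lnorm (D s)\<close>; its continuity is read off from
    \<open>\<kappa> / cosh \<theta>\<close>.\<close>
  have "continuous_on I \<theta>"
    using \<theta> by (meson DERIV_isCont continuous_at_imp_continuous_on)
  then have "continuous_on I (\<lambda>s. \<kappa> s / cosh (\<theta> s))"
    by (intro continuous_intros curvature_continuous_on[OF assms(1,4,5)]) auto
  then have "continuous_on I (\<lambda>s. lnorm (D s))"
    by (rule continuous_on_cong[THEN iffD1, rotated -1]) (simp_all add: assms(10))
  then have "\<exists>F. \<forall>s\<in>I. (F has_real_derivative lnorm (D s)) (at s)"
    by (rule continuous_on_open_interval_antiderivative[OF assms(1,2)])
  \<comment> \<open>Stated for every antiderivative, this serves both directions: forwards with the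
    one just shown to exist, backwards with the one supplied by the claim.\<close>
  moreover have "(\<forall>s\<in>I. \<theta>' s = x1 * x3 / (x3\<^sup>2 - x2\<^sup>2) * lnorm (D s)) \<longleftrightarrow>
      (\<exists>\<mu>. \<forall>s\<in>I. \<theta> s = x1 * x3 / (x3\<^sup>2 - x2\<^sup>2) * F s + \<mu>)"
    if "\<forall>s\<in>I. (F has_real_derivative lnorm (D s)) (at s)" for F
    using assms(1,2) that \<theta> by (rule affine_antiderivative_iff)
  ultimately show ?thesis
    unfolding dev by blast
qed

end
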